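(* Let $F$ be the fakeness budget and assume that $F$ is known to the platform. Then the expected regret of the FAR algorithm (run with input $F$ and $T$) satisfies $$\mathrm{Reg}_T=O\left(n^2F+\sum_{j=1}^n\sum_{i=j+1}^n\frac{\log(nT)}{\Delta_{j,i}}\right),$$ where $\Delta_{j,i}=\mu_j-\mu_i$ and the $O(\cdot)$ hides an absolute constant.
   Context: **Model.** There are $n$ products $[n]=\{1,\dots,n\}$, a horizon of $T$ rounds, click probabilities $\mu_1>\mu_2>\dots>\mu_n$ in $[0,1]$, and exit probabilities $q_1,\dots,q_{n-1}\in[0,1]$, all unknown to the platform. A ranking $\pi$ is a permutation; $\pi(j)=i$ means that product $i$ is in position $j$. In round $t$ the platform shows a ranking $\pi_t$ to one customer. A *real* customer examines positions $1,2,\dots$ in order; when examining the product $i$ in position $j$ she clicks on it with probability $\mu_i$ (independently of everything else) and then stops at position $j$; if she does not click, she exits at position $j$ with probability $q_j$ (independently) and otherwise moves to position $j+1$ (after position $n$ she exits). The platform observes $c_t\in(\{\emptyset\}\cup[n])\times[n]$: the clicked product (if any) and the exit position (the last examined position). **Fake users.** Let $f_t=1$ if the user in round $t$ is fake and $f_t=0$ otherwise, and $\mathcal H_t=\{(\pi_s,f_s,c_s)\}_{s\le t}$. A fake-user policy $\mathbf P=(P_t)_{t=1}^T$ maps each $\mathcal H_{t-1}$ to a (possibly randomized) action in round $t$: whether the user in round $t$ is fake and, if so, which (at most one) product is clicked (she then exits at that product's position) or, if none is clicked, at which position she exits. The platform does not observe $f_t$. $\mathcal P$ is the family of policies respecting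 the fakeness budget: $\sum_t f_t\le F$ always. **Regret.** $\mathcal C_{r,t}(\pi)=1$ if the customer in round $t$ is real and clicks on some product when shown $\pi$, and $0$ otherwise. Let $\pi^\star(i)=i$ for all $i$ (the optimal ranking). Then $$\mathrm{Reg}_T=\sup_{\mathbf P\in\mathcal P}\Big\{\mathbb E\Big[\sum_{t=1}^T\mathcal C_{r,t}(\pi^\star)\Big]-\mathbb E\Big[\sum_{t=1}^T\mathcal C_{r,t}(\pi_t)\Big]\Big\},$$ where the first expectation is over the history generated when $\pi^\star$ is shown in every round and the second over the history generated by the algorithm (both against $\mathbf P$). **Function GraphRankSelect$(\boldsymbol\eta,G)$.** Input: a directed graph $G$ on $[n]$ and counts $\boldsymbol\eta=(\eta_1,\dots,\eta_n)$. If $G$ has a cycle, return an arbitrary ranking. Otherwise set $S=[n]$ and for $j=1,\dots,n$: among the products of $S$ with no outgoing edge in $G$ to another product of $S$, choose one with the smallest $\eta_i$; set $\pi(j)=i$ and remove $i$ from $S$. Return $\pi$. **FAR algorithm.** Input $F,T$; $\delta=\frac1{nT}$. Initialize $r_i=0$, $\eta_i=0$ for all $i$ and $G=([n],\emptyset)$. In each round $t=1,\dots,T$: (1) show $\pi_t=$ GraphRankSelect$(\boldsymbol\eta,G)$ and observe $c_t$; (2) if $j$ is the last examined position, increase $\eta_i$ by one for each $i\in\{\pi_t(1),\dots,\pi_t(j)\}$ and update $r_i$ so that it is the fraction, among all rounds so far with feedback on $i$ (i.e. counted in $\eta_i$), in which $i$ was clicked; (3) for all $i,j\in[n]$ with $\eta_i,\eta_j>0$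 and $$r_i+\sqrt{\tfrac{\log(2nT/\delta)}{\eta_i}}+\tfrac{F}{\eta_i}\le r_j-\sqrt{\tfrac{\log(2nT/\delta)}{\eta_j}}-\tfrac{F}{\eta_j},$$ add the directed edge $(i,j)$ to $G$ (edges are never removed). $\log$ is the natural logarithm. *)

theory Defs
  imports "HOL-Probability.Probability" "HOL-Combinatorics.Permutations"
    "HOL-Library.Monad_Syntax"
begin

text \<open>
  Products and positions are the numbers \<open>1, \<dots>, n\<close>; a ranking maps positions to products
  and is a permutation of \<open>{1..n}\<close> (the identity elsewhere).  A feedback is the clicked
  product, if any, together with the last examined position.  Histories list the rounds in
  chronological order, so the current round number is determined by their length.
\<close>

type_synonym ranking = "nat \<Rightarrow> nat"
type_synonym feedback = "nat option \<times> nat"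
type_synonym observations = "(ranking \<times> feedback) list"
type_synonym history = "(ranking \<times> bool \<times> feedback) list"

datatype user_action = Real_User | Fake_Click nat | Fake_Exit nat

type_synonym platform = "observations \<Rightarrow> ranking pmf"
type_synonym fake_policy = "history \<Rightarrow> user_action pmf"

definition rankings :: "nat \<Rightarrow> ranking set" where
  "rankings n = {\<pi>. \<pi> permutes {1..n}}"

definition observed :: "history \<Rightarrow> observations" where
  "observed h = map (\<lambda>(\<pi>, f, c). (\<pi>, c)) h"

text \<open>
  \<open>examine \<mu> q \<pi> k j\<close> is the feedback of a real customer who is about to examine
  position \<open>j\<close>, with \<open>k\<close> further positions below it.
\<close>

primrec examine ::
  "(nat \<Rightarrow> real) \<Rightarrow> (nat \<Rightarrow> real) \<Rightarrow> ranking \<Rightarrow> nat \<Rightarrow> nat \<Rightarrow> feedback pmf" where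
  "examine \<mu> q \<pi> 0 j = do {
     click \<leftarrow> bernoulli_pmf (\<mu> (\<pi> j));
     return_pmf (if click then Some (\<pi> j) else None, j)
   }"
| "examine \<mu> q \<pi> (Suc k) j = do {
     click \<leftarrow> bernoulli_pmf (\<mu> (\<pi> j));
     if click then return_pmf (Some (\<pi> j), j)
     else do {
       leave \<leftarrow> bernoulli_pmf (q j);
       if leave then return_pmf (None, j) else examine \<mu> q \<pi> k (Suc j)
     }
   }"

fun response ::
  "nat \<Rightarrow> (nat \<Rightarrow> real) \<Rightarrow> (nat \<Rightarrow> real) \<Rightarrow> ranking \<Rightarrow> user_action \<Rightarrow> feedback pmf" where
  "response n \<mu> q \<pi> Real_User = examine \<mu> q \<pi> (n - 1) 1"
| "response n \<mu> q \<pi> (Fake_Click i) = return_pmf (Some i, inv \<pi> i)"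
| "response n \<mu> q \<pi> (Fake_Exit j) = return_pmf (None, j)"

text \<open>
  The platform sees neither the fake indicators nor the current action, and the fake-user
  policy acts on the history of the previous rounds only.
\<close>

primrec run ::
  "nat \<Rightarrow> (nat \<Rightarrow> real) \<Rightarrow> (nat \<Rightarrow> real) \<Rightarrow> platform \<Rightarrow> fake_policy \<Rightarrow> nat \<Rightarrow> history pmf" where
  "run n \<mu> q A P 0 = return_pmf []"
| "run n \<mu> q A P (Suc t) = do {
     h \<leftarrow> run n \<mu> q A P t;
     \<pi> \<leftarrow> A (observed h);
     a \<leftarrow> P h;
     c \<leftarrow> response n \<mu> q \<pi> a;
     return_pmf (h @ [(\<pi>, a \<noteq> Real_User, c)])
   }"

definition fake_count :: "history \<Rightarrow> nat" where
  "fake_count h = length (filter (\<lambda>(\<pi>, f, c). f) h)"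

definition real_clicks :: "history \<Rightarrow> nat" where
  "real_clicks h = length (filter (\<lambda>(\<pi>, f, c). \<not> f \<and> fst c \<noteq> None) h)"

definition valid_actions :: "nat \<Rightarrow> user_action set" where
  "valid_actions n = insert Real_User (Fake_Click ` {1..n} \<union> Fake_Exit ` {1..n})"

text \<open>
  The budget has to be respected with certainty, whatever rankings are shown.
\<close>

definition fake_policies ::
  "nat \<Rightarrow> nat \<Rightarrow> real \<Rightarrow> (nat \<Rightarrow> real) \<Rightarrow> (nat \<Rightarrow> real) \<Rightarrow> fake_policy set" where
  "fake_policies n T F \<mu> q =
     {P. (\<forall>h. set_pmf (P h) \<subseteq> valid_actions n) \<and>
         (\<forall>A. (\<forall>obs. set_pmf (A obs) \<subseteq> rankings n) \<longrightarrow>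
              (\<forall>h \<in> set_pmf (run n \<mu> q A P T). real (fake_count h) \<le> F))}"

definition expected_clicks ::
  "nat \<Rightarrow> nat \<Rightarrow> (nat \<Rightarrow> real) \<Rightarrow> (nat \<Rightarrow> real) \<Rightarrow> platform \<Rightarrow> fake_policy \<Rightarrow> real" where
  "expected_clicks n T \<mu> q A P =
     measure_pmf.expectation (run n \<mu> q A P T) (\<lambda>h. real (real_clicks h))"

text \<open>
  The optimal ranking is \<open>id\<close>.  For \<open>F \<ge> 0\<close> the supremum is over a nonempty set
  bounded by \<open>T\<close>.
\<close>

definition regret ::
  "nat \<Rightarrow> nat \<Rightarrow> real \<Rightarrow> (nat \<Rightarrow> real) \<Rightarrow> (nat \<Rightarrow> real) \<Rightarrow> platform \<Rightarrow> real" where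
  "regret n T F \<mu> q A =
     (SUP P \<in> fake_policies n T F \<mu> q.
        expected_clicks n T \<mu> q (\<lambda>_. return_pmf id) P - expected_clicks n T \<mu> q A P)"

text \<open>
  The possible outputs of GraphRankSelect: a relation, because the ranking returned for a
  cyclic graph and the resolution of ties are arbitrary.  When position \<open>j\<close> is filled, the
  set of remaining products is \<open>{1..n} - \<pi> ` {1..<j}\<close>.
\<close>

definition graph_rank_select ::
  "nat \<Rightarrow> (nat \<Rightarrow> nat) \<Rightarrow> (nat \<times> nat) set \<Rightarrow> ranking set" where
  "graph_rank_select n \<eta> G =
     {\<pi> \<in> rankings n. acyclic G \<longrightarrow>
        (\<forall>j \<in> {1..n}. let S = {1..n} - \<pi> ` {1..<j}
           in is_arg_min \<eta> (\<lambda>i. i \<in> S \<and> (\<forall>k \<in> S - {i}. (i, k) \<notin> G)) (\<pi> j))}"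

definition feedback_count :: "observations \<Rightarrow> nat \<Rightarrow> nat" where
  "feedback_count obs i = length (filter (\<lambda>(\<pi>, c). i \<in> \<pi> ` {1..snd c}) obs)"

text \<open>Without feedback on \<open>i\<close> the rate is \<open>0 / 0 = 0\<close>, its initial value.\<close>

definition click_rate :: "observations \<Rightarrow> nat \<Rightarrow> real" where
  "click_rate obs i =
     real (length (filter (\<lambda>(\<pi>, c). i \<in> \<pi> ` {1..snd c} \<and> fst c = Some i) obs))
       / real (feedback_count obs i)"

definition separated :: "nat \<Rightarrow> nat \<Rightarrow> real \<Rightarrow> observations \<Rightarrow> nat \<Rightarrow> nat \<Rightarrow> bool" where
  "separated n T F obs i j \<longleftrightarrow>
     (let \<delta> = 1 / (real n * real T);
          \<eta> = (\<lambda>k. real (feedback_count obs k));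
          r = click_rate obs;
          L = ln (2 * real n * real T / \<delta>)
      in \<eta> i > 0 \<and> \<eta> j > 0 \<and>
         r i + sqrt (L / \<eta> i) + F / \<eta> i \<le> r j - sqrt (L / \<eta> j) - F / \<eta> j)"

text \<open>Edges are never removed, so the graph collects the edges found after each round so far.\<close>

definition far_graph :: "nat \<Rightarrow> nat \<Rightarrow> real \<Rightarrow> observations \<Rightarrow> (nat \<times> nat) set" where
  "far_graph n T F obs =
     {(i, j). i \<in> {1..n} \<and> j \<in> {1..n} \<and>
        (\<exists>s \<in> {1..length obs}. separated n T F (take s obs) i j)}"

text \<open>
  An implementation of FAR may resolve the arbitrary choices in GraphRankSelect in any way,
  including at random or depending on past observations.
\<close>

definition is_FAR :: "nat \<Rightarrow> nat \<Rightarrow> real \<Rightarrow> platform \<Rightarrow> bool" where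
  "is_FAR n T F A \<longleftrightarrow>
     (\<forall>obs. set_pmf (A obs) \<subseteq>
        graph_rank_select n (feedback_count obs) (far_graph n T F obs))"

end

theory Submission
  imports Defs "HOL-Probability.Hoeffding"
begin

text \<open>
  Charge each real customer, for every position \<open>j\<close> she examines, the gap between the best
  product not shown above \<open>j\<close> and the product shown at \<open>j\<close>; up to the lost clicks of at most
  \<open>F\<close> fake rounds, the expected total charge bounds the regret.  Exponential supermartingales
  show that, with high probability, the observed click rate of every product is within
  \<open>sqrt (L / \<eta>) + F / \<eta>\<close> of its click probability in all rounds.  Then the graph has only
  correct edges, and if \<open>a\<close> is shown although the better \<open>b\<close> is the best one left, \<open>a\<close> has at
  most as much feedback as \<open>b\<close> and the two are not separated, so \<open>\<eta> a = O (L / \<Delta>\<^sup>2 + F / \<Delta>)\<close>.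
  As every charge to the pair increases \<open>\<eta> a\<close>, the pair pays \<open>O (L / \<Delta> + F)\<close> in total.
\<close>

section \<open>Expectations over finite distributions\<close>

lemma expectation_bind_pmf:
  fixes g :: "'b \<Rightarrow> real"
  assumes "finite (set_pmf p)" "\<And>x. x \<in> set_pmf p \<Longrightarrow> finite (set_pmf (f x))"
  shows "measure_pmf.expectation (p \<bind> f) g =
    measure_pmf.expectation p (\<lambda>x. measure_pmf.expectation (f x) g)"
  by (subst pmf_expectation_bind[OF assms(1)])
     (use assms in \<open>auto simp: integral_measure_pmf[OF assms(1)]\<close>)

lemma expectation_pmf_mono:
  fixes f g :: "'a \<Rightarrow> real"
  assumes "finite (set_pmf p)" "\<And>x. x \<in> set_pmf p \<Longrightarrow> f x \<le> g x"
  shows "measure_pmf.expectation p f \<le> measure_pmf.expectation p g"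
  using assms by (intro integral_mono_AE integrable_measure_pmf_finite) (auto simp: AE_measure_pmf_iff)

lemma expectation_pmf_cong:
  fixes f g :: "'a \<Rightarrow> real"
  assumes "\<And>x. x \<in> set_pmf p \<Longrightarrow> f x = g x"
  shows "measure_pmf.expectation p f = measure_pmf.expectation p g"
  using assms by (intro integral_cong_AE) (auto simp: AE_measure_pmf_iff)

lemma expectation_pmf_le:
  fixes f :: "'a \<Rightarrow> real"
  assumes "finite (set_pmf p)" "\<And>x. x \<in> set_pmf p \<Longrightarrow> f x \<le> c"
  shows "measure_pmf.expectation p f \<le> c"
  using expectation_pmf_mono[OF assms(1), of f "\<lambda>_. c"] assms(2) by simp

text \<open>Hoeffding's lemma for a centred Bernoulli variable. The factor
  \<open>exp (- l\<^sup>2 / 8)\<close> is moved into both exponents, which gives the one-round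
  factor of an exponential supermartingale.\<close>

lemma bernoulli_exp_bound:
  fixes p l :: real
  assumes "0 \<le> p" "p \<le> 1"
  shows "p * exp (l * (1 - p) - l\<^sup>2 / 8) + (1 - p) * exp (- (l * p) - l\<^sup>2 / 8) \<le> 1"
proof -
  have nonneg: "p * exp (l * (1 - p)) + (1 - p) * exp (- (l * p)) \<le> exp (l\<^sup>2 / 8)"
    if "0 \<le> l" "0 \<le> p" "p \<le> 1" for l p :: real
  proof -
    have pos: "0 < 1 + p * (exp l - 1)"
      using that by (smt (verit) mult_nonneg_nonneg one_le_exp_iff)
    have "p * exp (l * (1 - p)) + (1 - p) * exp (- (l * p)) = exp (- l * p) * (1 + p * (exp l - 1))"
      by (simp add: algebra_simps flip: exp_add)
    also have "\<dots> = exp (- l * p + ln (1 + p * (exp l - 1)))"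
      using pos by (simp only: exp_add exp_ln)
    also have "\<dots> \<le> exp (l\<^sup>2 / 8)"
      using Hoeffdings_lemma_aux[of l p] that by simp
    finally show ?thesis .
  qed
  have "p * exp (l * (1 - p)) + (1 - p) * exp (- (l * p)) \<le> exp (l\<^sup>2 / 8)"
  \<comment> \<open>Exchanging success and failure turns \<open>(l, p)\<close> into
    \<open>(- l, 1 - p)\<close> and so reduces negative \<open>l\<close> to the case above.\<close>
  proof (cases "l \<ge> 0")
    case False
    then show ?thesis
      using nonneg[of "- l" "1 - p"] assms by (simp add: algebra_simps)
  qed (use assms nonneg in auto)
  then show ?thesis
    by (simp add: exp_diff flip: add_divide_distrib)
qed

section \<open>One round\<close>

definition feedback_on :: "nat \<Rightarrow> ranking \<Rightarrow> feedback \<Rightarrow> bool" where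
  "feedback_on i \<pi> c \<longleftrightarrow> i \<in> \<pi> ` {1..snd c}"

text \<open>Real rounds are counted apart because only they concentrate; the statistics seen by the
  platform mix them with fake rounds.\<close>

definition real_feedback :: "history \<Rightarrow> nat \<Rightarrow> nat" where
  "real_feedback h i = length (filter (\<lambda>(\<pi>, f, c). \<not> f \<and> feedback_on i \<pi> c) h)"

definition real_clicks_on :: "history \<Rightarrow> nat \<Rightarrow> nat" where
  "real_clicks_on h i =
     length (filter (\<lambda>(\<pi>, f, c). \<not> f \<and> feedback_on i \<pi> c \<and> fst c = Some i) h)"

text \<open>Click probabilities decrease in the index, so \<open>Min\<close> selects the best
  product not shown above \<open>j\<close>.\<close>

definition best_left :: "nat \<Rightarrow> ranking \<Rightarrow> nat \<Rightarrow> nat" where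
  "best_left n \<pi> j = Min ({1..n} - \<pi> ` {1..<j})"

definition gap :: "nat \<Rightarrow> (nat \<Rightarrow> real) \<Rightarrow> ranking \<Rightarrow> nat \<Rightarrow> real" where
  "gap n \<mu> \<pi> j = \<mu> (best_left n \<pi> j) - \<mu> (\<pi> j)"

definition round_loss :: "nat \<Rightarrow> (nat \<Rightarrow> real) \<Rightarrow> ranking \<times> bool \<times> feedback \<Rightarrow> real" where
  "round_loss n \<mu> = (\<lambda>(\<pi>, f, c). if f then 0 else \<Sum>j = 1..snd c. gap n \<mu> \<pi> j)"

definition loss :: "nat \<Rightarrow> (nat \<Rightarrow> real) \<Rightarrow> history \<Rightarrow> real" where
  "loss n \<mu> h = (\<Sum>x\<leftarrow>h. round_loss n \<mu> x)"

locale market =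
  fixes n :: nat and \<mu> q :: "nat \<Rightarrow> real"
  assumes n_ge_1: "n \<ge> 1"
    and \<mu>_range: "i \<in> {1..n} \<Longrightarrow> 0 \<le> \<mu> i \<and> \<mu> i \<le> 1"
    and \<mu>_decr: "i \<in> {1..n} \<Longrightarrow> j \<in> {1..n} \<Longrightarrow> i < j \<Longrightarrow> \<mu> j < \<mu> i"
    and q_range: "j \<in> {1..<n} \<Longrightarrow> 0 \<le> q j \<and> q j \<le> 1"
begin

lemma \<mu>_antimono: "i \<in> {1..n} \<Longrightarrow> j \<in> {1..n} \<Longrightarrow> i \<le> j \<Longrightarrow> \<mu> j \<le> \<mu> i"
  using \<mu>_decr[of i j] by (cases "i = j") auto

lemma finite_rankings: "finite (rankings n)"
  by (simp add: rankings_def finite_permutations)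

lemma finite_set_pmf_examine: "finite (set_pmf (examine \<mu> q \<pi> k j))"
  by (induction k arbitrary: j) (auto simp: set_pmf_bernoulli)

lemma finite_set_pmf_response: "finite (set_pmf (response n \<mu> q \<pi> a))"
  by (cases a) (auto simp: finite_set_pmf_examine)

lemma set_pmf_examine:
  "c \<in> set_pmf (examine \<mu> q \<pi> k j) \<Longrightarrow>
     j \<le> snd c \<and> snd c \<le> j + k \<and> (fst c = None \<or> fst c = Some (\<pi> (snd c)))"
proof (induction k arbitrary: j)
  case 0
  then show ?case by (auto split: if_splits)
next
  case (Suc k)
  then show ?case
    by (fastforce split: if_splits dest: Suc.IH)
qed

lemma expectation_examine_0:
  fixes g :: "feedback \<Rightarrow> real"
  assumes "\<pi> j \<in> {1..n}"
  shows "measure_pmf.expectation (examine \<mu> q \<pi> 0 j) g =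
    \<mu> (\<pi> j) * g (Some (\<pi> j), j) + (1 - \<mu> (\<pi> j)) * g (None, j)"
  using \<mu>_range[OF assms] by (simp add: expectation_bind_pmf)

lemma expectation_examine_Suc:
  fixes g :: "feedback \<Rightarrow> real"
  assumes "\<pi> j \<in> {1..n}" "j \<in> {1..<n}"
  shows "measure_pmf.expectation (examine \<mu> q \<pi> (Suc k) j) g =
    \<mu> (\<pi> j) * g (Some (\<pi> j), j) + (1 - \<mu> (\<pi> j)) *
      (q j * g (None, j) + (1 - q j) * measure_pmf.expectation (examine \<mu> q \<pi> k (Suc j)) g)"
  using \<mu>_range[OF assms(1)] q_range[OF assms(2)]
  by (simp add: expectation_bind_pmf finite_set_pmf_examine)

lemma best_left_mem:
  assumes "\<pi> \<in> rankings n" "j \<in> {1..n}"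
  shows "best_left n \<pi> j \<in> {1..n} - \<pi> ` {1..<j}" "best_left n \<pi> j \<le> j"
    "best_left n \<pi> j \<le> \<pi> j" "\<pi> j \<in> {1..n}"
proof -
  have \<pi>: "\<pi> permutes {1..n}" using assms by (simp add: rankings_def)
  show \<pi>j: "\<pi> j \<in> {1..n}" by (rule iffD2[OF permutes_in_image[OF \<pi>] assms(2)])
  have "\<pi> j \<notin> \<pi> ` {1..<j}"
    using inj_image_mem_iff[OF permutes_inj[OF \<pi>], of j "{1..<j}"] by simp
  then have mem: "\<pi> j \<in> {1..n} - \<pi> ` {1..<j}" using \<pi>j by simp
  then show "best_left n \<pi> j \<in> {1..n} - \<pi> ` {1..<j}"
    unfolding best_left_def by (intro Min_in) auto
  show "best_left n \<pi> j \<le> \<pi> j"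
    unfolding best_left_def using mem by (intro Min_le) auto
  \<comment> \<open>Pigeonhole: the \<open>j - 1\<close> positions above \<open>j\<close> cannot
    hold all of the products \<open>1, ..., j\<close>.\<close>
  have "\<not> {1..j} \<subseteq> \<pi> ` {1..<j}"
  proof
    assume "{1..j} \<subseteq> \<pi> ` {1..<j}"
    then have "card {1..j} \<le> card (\<pi> ` {1..<j})" by (intro card_mono) auto
    also have "\<dots> \<le> card {1..<j}" by (rule card_image_le) simp
    finally show False using assms(2) by auto
  qed
  then obtain i where "i \<in> {1..j}" "i \<notin> \<pi> ` {1..<j}" by blast
  then have "best_left n \<pi> j \<le> i"
    unfolding best_left_def using assms(2) by (intro Min_le) auto
  then show "best_left n \<pi> j \<le> j" using \<open>i \<in> {1..j}\<close> by simp
qed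

lemma gap_nonneg:
  assumes "\<pi> \<in> rankings n" "j \<in> {1..n}"
  shows "gap n \<mu> \<pi> j \<ge> 0"
  using best_left_mem[OF assms] \<mu>_antimono by (simp add: gap_def)

section \<open>Clicks of one real customer, compared with the optimal ranking\<close>

definition click_prob :: real where
  "click_prob = measure_pmf.expectation (examine \<mu> q id (n - 1) 1) (\<lambda>c. of_bool (fst c \<noteq> None))"

lemma click_prob_bounds: "0 \<le> click_prob" "click_prob \<le> 1"
  unfolding click_prob_def
  by (auto intro!: integral_nonneg expectation_pmf_le simp: finite_set_pmf_examine)

text \<open>
  The best remaining product has index at most
  \<open>j\<close>, so crediting the ranking with the gap raises the click probability of position \<open>j\<close>
  from \<open>\<mu> (\<pi> j)\<close> to at least \<open>\<mu> j\<close>, without lowering the probability of going on.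
\<close>

lemma examine_loss_aux:
  assumes "\<pi> \<in> rankings n" "j \<ge> 1" "j + k \<le> n"
  shows "measure_pmf.expectation (examine \<mu> q id k j) (\<lambda>c. of_bool (fst c \<noteq> None))
    \<le> measure_pmf.expectation (examine \<mu> q \<pi> k j)
        (\<lambda>c. of_bool (fst c \<noteq> None) + (\<Sum>l = j..snd c. gap n \<mu> \<pi> l))"
  using assms(2,3)
proof (induction k arbitrary: j)
  case 0
  then have j: "j \<in> {1..n}" by simp
  note b = best_left_mem[OF assms(1) j]
  have "\<mu> j \<le> \<mu> (best_left n \<pi> j)" using b j by (intro \<mu>_antimono) auto
  then show ?case
    using j b(4) by (simp add: expectation_examine_0 gap_def algebra_simps del: examine.simps)
next
  case (Suc k)
  then have j: "j \<in> {1..n}" "j \<in> {1..<n}" by simp_all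
  note b = best_left_mem[OF assms(1) j(1)]
  have mono: "\<mu> j \<le> \<mu> (best_left n \<pi> j)" using b j by (intro \<mu>_antimono) auto
  let ?G = "\<lambda>j c. of_bool (fst c \<noteq> None) + (\<Sum>l = j..snd c. gap n \<mu> \<pi> l) :: real"
  define V where "V = measure_pmf.expectation (examine \<mu> q id k (Suc j)) (\<lambda>c. of_bool (fst c \<noteq> None) :: real)"
  define W where "W = measure_pmf.expectation (examine \<mu> q \<pi> k (Suc j)) (?G (Suc j))"
  have VW: "V \<le> W" unfolding V_def W_def by (intro Suc.IH) (use Suc.prems in auto)
  have V: "0 \<le> V" "V \<le> 1"
    unfolding V_def by (auto intro!: integral_nonneg expectation_pmf_le simp: finite_set_pmf_examine)
  \<comment> \<open>A customer who goes on exits at \<open>Suc j\<close> or later, so the gap at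
    \<open>j\<close> is charged for certain and leaves the expectation as a constant.\<close>
  have "measure_pmf.expectation (examine \<mu> q \<pi> k (Suc j)) (?G j)
      = measure_pmf.expectation (examine \<mu> q \<pi> k (Suc j)) (\<lambda>c. gap n \<mu> \<pi> j + ?G (Suc j) c)"
    by (intro expectation_pmf_cong)
       (use set_pmf_examine in \<open>fastforce simp: sum.atLeast_Suc_atMost\<close>)
  also have "\<dots> = gap n \<mu> \<pi> j + W"
    unfolding W_def
    by (subst Bochner_Integration.integral_add)
       (auto intro: integrable_measure_pmf_finite finite_set_pmf_examine)
  finally have W: "measure_pmf.expectation (examine \<mu> q \<pi> k (Suc j)) (?G j) = gap n \<mu> \<pi> j + W" .
  let ?B = "\<mu> (best_left n \<pi> j)"
  have qj: "0 \<le> q j" "q j \<le> 1" using q_range j by auto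
  have "measure_pmf.expectation (examine \<mu> q id (Suc k) j) (\<lambda>c. of_bool (fst c \<noteq> None))
      = \<mu> j + (1 - \<mu> j) * ((1 - q j) * V)"
    using j by (simp add: expectation_examine_Suc V_def del: examine.simps)
  \<comment> \<open>A click is worth 1 and going on is worth at most 1, so raising the click
    probability to \<open>?B\<close> cannot lower the value.\<close>
  also have "\<dots> \<le> ?B + (1 - ?B) * ((1 - q j) * V)"
  proof -
    have "(1 - q j) * V \<le> 1" using V qj by (simp add: mult_le_one)
    then have "0 \<le> (?B - \<mu> j) * (1 - (1 - q j) * V)" using mono by simp
    then show ?thesis by (simp add: algebra_simps)
  qed
  also have "\<dots> \<le> ?B + (1 - \<mu> (\<pi> j)) * ((1 - q j) * W)"
  proof -
    have "\<mu> (\<pi> j) \<le> ?B" "?B \<le> 1" using b \<mu>_antimono \<mu>_range by auto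
    then show ?thesis using V VW qj
      by (intro add_left_mono mult_mono) auto
  qed
  \<comment> \<open>The gap is charged whether or not there is a click, and
    \<open>\<mu> (\<pi> j)\<close> plus the gap is \<open>?B\<close>.\<close>
  also have "\<dots> = measure_pmf.expectation (examine \<mu> q \<pi> (Suc k) j) (?G j)"
    unfolding expectation_examine_Suc[of \<pi> j, OF b(4) j(2)] W
    by (simp add: gap_def algebra_simps)
  finally show ?case .
qed

lemma examine_loss:
  assumes "\<pi> \<in> rankings n"
  shows "click_prob \<le> measure_pmf.expectation (examine \<mu> q \<pi> (n - 1) 1)
           (\<lambda>c. of_bool (fst c \<noteq> None) + (\<Sum>l = 1..snd c. gap n \<mu> \<pi> l))"
  unfolding click_prob_def using examine_loss_aux[OF assms, of 1 "n - 1"] n_ge_1 by simp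

text \<open>Before position \<open>p\<close> the expectation is a convex combination of 1, for
  stopping there, and the value one position further down; at \<open>p\<close> itself the click is
  Bernoulli and \<open>bernoulli_exp_bound\<close> applies.\<close>

lemma examine_exp_bound_aux:
  fixes l :: real
  assumes "\<pi> \<in> rankings n" "p \<in> {1..n}" "1 \<le> j" "j \<le> p" "p \<le> j + k" "j + k \<le> n"
  shows "measure_pmf.expectation (examine \<mu> q \<pi> k j)
      (\<lambda>c. if p \<le> snd c then exp (l * (of_bool (fst c = Some (\<pi> p)) - \<mu> (\<pi> p)) - l\<^sup>2 / 8) else 1) \<le> 1"
  using assms(3-)
proof (induction k arbitrary: j)
  case 0
  then have "j = p" by simp
  then show ?case
    using best_left_mem(4)[OF assms(1,2)] bernoulli_exp_bound[of "\<mu> (\<pi> p)" l] \<mu>_range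
    by (simp add: expectation_examine_0 del: examine.simps)
next
  case (Suc k)
  let ?g = "\<lambda>c. if p \<le> snd c
    then exp (l * (of_bool (fst c = Some (\<pi> p)) - \<mu> (\<pi> p)) - l\<^sup>2 / 8) else 1 :: real"
  have j: "j \<in> {1..n}" "j \<in> {1..<n}" using Suc.prems by auto
  have \<pi>j: "\<pi> j \<in> {1..n}" using best_left_mem(4)[OF assms(1) j(1)] .
  have qj: "0 \<le> q j" "q j \<le> 1" using q_range j by auto
  have \<mu>j: "0 \<le> \<mu> (\<pi> j)" "\<mu> (\<pi> j) \<le> 1" using \<mu>_range \<pi>j by auto
  let ?E = "measure_pmf.expectation (examine \<mu> q \<pi> k (Suc j)) ?g"
  show ?case
  proof (cases "j = p")
    case True
    \<comment> \<open>Once \<open>p\<close> is passed without a click, any later click is on another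
      product by injectivity, so the factor is already determined.\<close>
    have inj: "inj \<pi>" using assms(1) by (auto simp: rankings_def permutes_inj)
    have "?g c = exp (- (l * \<mu> (\<pi> p)) - l\<^sup>2 / 8)"
      if "c \<in> set_pmf (examine \<mu> q \<pi> k (Suc j))" for c
      using set_pmf_examine[OF that] True injD[OF inj, of "snd c" p] by auto
    then have "?E = measure_pmf.expectation (examine \<mu> q \<pi> k (Suc j))
        (\<lambda>_. exp (- (l * \<mu> (\<pi> p)) - l\<^sup>2 / 8))"
      by (rule expectation_pmf_cong)
    then have E: "?E = exp (- (l * \<mu> (\<pi> p)) - l\<^sup>2 / 8)" by simp
    have "measure_pmf.expectation (examine \<mu> q \<pi> (Suc k) j) ?g
        = \<mu> (\<pi> p) * exp (l * (1 - \<mu> (\<pi> p)) - l\<^sup>2 / 8)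
          + (1 - \<mu> (\<pi> p)) * exp (- (l * \<mu> (\<pi> p)) - l\<^sup>2 / 8)"
      unfolding expectation_examine_Suc[of \<pi> j, OF \<pi>j j(2)] E
      using True by (simp add: distrib_right[symmetric] del: examine.simps)
    also have "\<dots> \<le> 1"
      using bernoulli_exp_bound[of "\<mu> (\<pi> p)" l] \<mu>j True by simp
    finally show ?thesis .
  next
    case False
    then have "?E \<le> 1" using Suc by simp
    then have "q j + (1 - q j) * ?E \<le> 1"
      using qj mult_left_mono[of ?E 1 "1 - q j"] by simp
    then have "(1 - \<mu> (\<pi> j)) * (q j + (1 - q j) * ?E) \<le> 1 - \<mu> (\<pi> j)"
      using \<mu>j mult_left_mono[of _ 1 "1 - \<mu> (\<pi> j)"] by simp
    then show ?thesis
      unfolding expectation_examine_Suc[of \<pi> j, OF \<pi>j j(2)]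
      using False Suc.prems by (simp del: examine.simps)
  qed
qed

lemma examine_exp_bound:
  fixes l :: real
  assumes "\<pi> \<in> rankings n" "i \<in> {1..n}"
  shows "measure_pmf.expectation (examine \<mu> q \<pi> (n - 1) 1)
      (\<lambda>c. if feedback_on i \<pi> c then exp (l * (of_bool (fst c = Some i) - \<mu> i) - l\<^sup>2 / 8) else 1) \<le> 1"
proof -
  have \<pi>: "\<pi> permutes {1..n}" using assms by (simp add: rankings_def)
  then obtain p where p: "p \<in> {1..n}" "\<pi> p = i" by (metis assms(2) imageE permutes_image)
  have "feedback_on i \<pi> c \<longleftrightarrow> p \<le> snd c" for c
    using p inj_image_mem_iff[OF permutes_inj[OF \<pi>], of p "{1..snd c}"]
    by (simp add: feedback_on_def)
  then show ?thesis
    using examine_exp_bound_aux[OF assms(1) p(1), of 1 "n - 1" l, unfolded p(2)] p(1) n_ge_1 by simp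
qed

end

section \<open>Runs\<close>

text \<open>All prefixes are covered because an edge may stem from any earlier round. Deviations are
  of counts; division by \<open>m\<close> gives the radius \<open>sqrt (L / m)\<close>. They are
  strict because the test in \<open>separated\<close> is not.\<close>

definition concentrated :: "nat \<Rightarrow> (nat \<Rightarrow> real) \<Rightarrow> real \<Rightarrow> history \<Rightarrow> bool" where
  "concentrated n \<mu> L h \<longleftrightarrow> (\<forall>s \<le> length h. \<forall>i \<in> {1..n}. let m = real (real_feedback (take s h) i) in
     m > 0 \<longrightarrow> \<bar>real (real_clicks_on (take s h) i) - m * \<mu> i\<bar> < sqrt (L * m))"

lemma real_feedback_le_length: "real_feedback h i \<le> length h"
  unfolding real_feedback_def by (rule length_filter_le)

lemma finite_valid_actions: "finite (valid_actions n)"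
  by (simp add: valid_actions_def)

text \<open>\<open>R\<close> is the set of rankings that may be shown: \<open>{id}\<close> for the
  optimal run, all rankings for FAR.\<close>

locale market_run = market +
  fixes R :: "ranking set" and A :: platform and P :: fake_policy
  assumes R_rankings: "R \<subseteq> rankings n"
    and A_range: "set_pmf (A obs) \<subseteq> R"
    and P_range: "set_pmf (P h) \<subseteq> valid_actions n"
begin

lemma finite_set_pmf_A: "finite (set_pmf (A obs))"
  by (meson A_range R_rankings finite_rankings finite_subset)

lemma finite_set_pmf_P: "finite (set_pmf (P h))"
  by (meson P_range finite_subset finite_valid_actions)

lemma finite_set_pmf_run: "finite (set_pmf (run n \<mu> q A P t))"
  by (induction t)
     (auto simp: finite_set_pmf_A finite_set_pmf_P finite_set_pmf_response)

lemma integrable_run: "integrable (measure_pmf (run n \<mu> q A P t)) (g :: history \<Rightarrow> real)"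
  by (intro integrable_measure_pmf_finite finite_set_pmf_run)

text \<open>The one-round bound holds for every ranking and action, hence also on average over
  choices that depend on the history. This handles the adaptivity of platform and fake users for all
  potentials below.\<close>

lemma run_supermartingale:
  fixes g :: "history \<Rightarrow> real"
  assumes step: "\<And>h \<pi> a. \<pi> \<in> R \<Longrightarrow> a \<in> valid_actions n \<Longrightarrow>
    measure_pmf.expectation (response n \<mu> q \<pi> a) (\<lambda>c. g (h @ [(\<pi>, a \<noteq> Real_User, c)])) \<le> g h"
  shows "measure_pmf.expectation (run n \<mu> q A P t) g \<le> g []"
proof (induction t)
  case (Suc t)
  have "measure_pmf.expectation (run n \<mu> q A P (Suc t)) g =
    measure_pmf.expectation (run n \<mu> q A P t) (\<lambda>h.
      measure_pmf.expectation (A (observed h)) (\<lambda>\<pi>.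
        measure_pmf.expectation (P h) (\<lambda>a.
          measure_pmf.expectation (response n \<mu> q \<pi> a) (\<lambda>c. g (h @ [(\<pi>, a \<noteq> Real_User, c)])))))"
    by (simp add: expectation_bind_pmf finite_set_pmf_run finite_set_pmf_A finite_set_pmf_P
        finite_set_pmf_response)
  also have "\<dots> \<le> measure_pmf.expectation (run n \<mu> q A P t) g"
    using A_range P_range
    by (intro expectation_pmf_mono expectation_pmf_le finite_set_pmf_run finite_set_pmf_A
        finite_set_pmf_P step) auto
  finally show ?case using Suc by simp
qed simp

lemma run_support:
  assumes "h \<in> set_pmf (run n \<mu> q A P t)"
  shows "length h = t"
    "\<And>s. s < t \<Longrightarrow> fst (h ! s) \<in> set_pmf (A (observed (take s h)))"
    "\<And>s. s < t \<Longrightarrow> \<not> fst (snd (h ! s)) \<Longrightarrow> snd (snd (snd (h ! s))) \<le> n"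
proof -
  have "length h = t \<and> (\<forall>s < t. fst (h ! s) \<in> set_pmf (A (observed (take s h))) \<and>
      (\<not> fst (snd (h ! s)) \<longrightarrow> snd (snd (snd (h ! s))) \<le> n))"
    using assms
  proof (induction t arbitrary: h)
    case (Suc t)
    then obtain h' \<pi> a c where h': "h' \<in> set_pmf (run n \<mu> q A P t)" and \<pi>: "\<pi> \<in> set_pmf (A (observed h'))"
      and c: "c \<in> set_pmf (response n \<mu> q \<pi> a)" and h: "h = h' @ [(\<pi>, a \<noteq> Real_User, c)]"
      by auto
    have "snd c \<le> n" if "a = Real_User"
      using set_pmf_examine[of c \<pi> "n - 1" 1] c that n_ge_1 by auto
    then show ?case
      using Suc.IH[OF h'] \<pi> by (auto simp: h nth_append less_Suc_eq)
  qed simp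
  then show "length h = t"
    "\<And>s. s < t \<Longrightarrow> fst (h ! s) \<in> set_pmf (A (observed (take s h)))"
    "\<And>s. s < t \<Longrightarrow> \<not> fst (snd (h ! s)) \<Longrightarrow> snd (snd (snd (h ! s))) \<le> n"
    by auto
qed

text \<open>Later rounds do not influence earlier ones. This carries a bound for runs of length
  \<open>s\<close> over to the prefixes of a longer run.\<close>

lemma map_take_run:
  assumes "s \<le> t"
  shows "map_pmf (take s) (run n \<mu> q A P t) = run n \<mu> q A P s"
  using assms
proof (induction t rule: dec_induct)
  case base
  have "map_pmf (take s) (run n \<mu> q A P s) = map_pmf id (run n \<mu> q A P s)"
    using run_support(1) by (intro map_pmf_cong) auto
  then show ?case by simp
next
  case (step t)
  have "map_pmf (take s) (run n \<mu> q A P (Suc t)) =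
      run n \<mu> q A P t \<bind> (\<lambda>h. A (observed h) \<bind> (\<lambda>\<pi>. P h \<bind> (\<lambda>a. response n \<mu> q \<pi> a \<bind>
        (\<lambda>c. return_pmf (take s (h @ [(\<pi>, a \<noteq> Real_User, c)]))))))"
    by (simp add: map_bind_pmf)
  also have "\<dots> = run n \<mu> q A P t \<bind> (\<lambda>h. return_pmf (take s h))"
  proof (intro bind_pmf_cong refl)
    fix h assume "h \<in> set_pmf (run n \<mu> q A P t)"
    then have "take s (h @ [x]) = take s h" for x
      using run_support(1) step by simp
    then show "A (observed h) \<bind> (\<lambda>\<pi>. P h \<bind> (\<lambda>a. response n \<mu> q \<pi> a \<bind>
        (\<lambda>c. return_pmf (take s (h @ [(\<pi>, a \<noteq> Real_User, c)]))))) = return_pmf (take s h)"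
      by simp
  qed
  finally show ?case using step by (simp add: map_pmf_def)
qed

text \<open>By \<open>examine_loss\<close>, a real round yields clicks plus charge of at least
  \<open>click_prob\<close> on average; a fake round changes neither side. So the difference is a
  supermartingale.\<close>

lemma expectation_clicks_lower:
  "click_prob * (real t - measure_pmf.expectation (run n \<mu> q A P t) (\<lambda>h. real (fake_count h)))
     \<le> expected_clicks n t \<mu> q A P + measure_pmf.expectation (run n \<mu> q A P t) (loss n \<mu>)"
proof -
  let ?g = "\<lambda>h. click_prob * (real (length h) - real (fake_count h)) - (real (real_clicks h) + loss n \<mu> h)"
  have "measure_pmf.expectation (run n \<mu> q A P t) ?g \<le> ?g []"
  proof (rule run_supermartingale)
    fix h :: history and \<pi> a
    assume \<pi>: "\<pi> \<in> R" and a: "a \<in> valid_actions n"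
    show "measure_pmf.expectation (response n \<mu> q \<pi> a) (\<lambda>c. ?g (h @ [(\<pi>, a \<noteq> Real_User, c)])) \<le> ?g h"
    proof (cases "a = Real_User")
      case True
      let ?G = "\<lambda>c. of_bool (fst c \<noteq> None) + (\<Sum>l = 1..snd c. gap n \<mu> \<pi> l) :: real"
      let ?M = "examine \<mu> q \<pi> (n - 1) 1"
      have "measure_pmf.expectation ?M (\<lambda>c. ?g (h @ [(\<pi>, False, c)]))
          = measure_pmf.expectation ?M (\<lambda>c. (?g h + click_prob) - ?G c)"
        by (intro expectation_pmf_cong)
           (auto simp: fake_count_def real_clicks_def loss_def round_loss_def algebra_simps)
      also have "\<dots> = (?g h + click_prob) - measure_pmf.expectation ?M ?G"
        by (subst Bochner_Integration.integral_diff)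
           (auto intro: integrable_measure_pmf_finite finite_set_pmf_examine)
      also have "\<dots> \<le> ?g h" using examine_loss[of \<pi>] \<pi> R_rankings by auto
      finally show ?thesis using True by simp
    next
      case False
      then show ?thesis
        by (intro expectation_pmf_le finite_set_pmf_response)
           (auto simp: fake_count_def real_clicks_def loss_def round_loss_def)
    qed
  qed
  also have "?g [] = 0"
    by (simp add: fake_count_def real_clicks_def loss_def)
  also have "measure_pmf.expectation (run n \<mu> q A P t) ?g =
      measure_pmf.expectation (run n \<mu> q A P t)
        (\<lambda>h. click_prob * (real t - real (fake_count h)) - (real (real_clicks h) + loss n \<mu> h))"
    using run_support(1) by (intro expectation_pmf_cong) simp
  also have "\<dots> = click_prob * (real t - measure_pmf.expectation (run n \<mu> q A P t) (\<lambda>h. real (fake_count h)))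
     - (expected_clicks n t \<mu> q A P + measure_pmf.expectation (run n \<mu> q A P t) (loss n \<mu>))"
    by (simp add: expected_clicks_def integrable_run)
  finally show ?thesis by simp
qed

text \<open>A real round adds exactly \<open>click_prob\<close>, a fake one nothing. The fake rounds
  of this run are not subtracted, since their number may differ from that in the run of the
  algorithm.\<close>

lemma expectation_clicks_id_upper:
  assumes "R = {id}"
  shows "expected_clicks n t \<mu> q A P \<le> click_prob * real t"
proof -
  let ?g = "\<lambda>h. real (real_clicks h) - click_prob * real (length h)"
  have "measure_pmf.expectation (run n \<mu> q A P t) ?g \<le> ?g []"
  proof (rule run_supermartingale)
    fix h :: history and \<pi> a
    assume \<pi>: "\<pi> \<in> R" and a: "a \<in> valid_actions n"
    show "measure_pmf.expectation (response n \<mu> q \<pi> a) (\<lambda>c. ?g (h @ [(\<pi>, a \<noteq> Real_User, c)])) \<le> ?g h"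
    proof (cases "a = Real_User")
      case True
      let ?M = "examine \<mu> q id (n - 1) 1"
      have "measure_pmf.expectation ?M (\<lambda>c. ?g (h @ [(id, False, c)]))
          = measure_pmf.expectation ?M (\<lambda>c. (?g h - click_prob) + of_bool (fst c \<noteq> None))"
        by (intro expectation_pmf_cong) (auto simp: real_clicks_def algebra_simps)
      also have "\<dots> = (?g h - click_prob) + click_prob"
        unfolding click_prob_def[symmetric]
        by (subst Bochner_Integration.integral_add)
           (auto simp: click_prob_def intro: integrable_measure_pmf_finite finite_set_pmf_examine)
      finally show ?thesis using True \<pi> assms by simp
    next
      case False
      then show ?thesis
        by (intro expectation_pmf_le finite_set_pmf_response)
           (auto simp: real_clicks_def algebra_simps click_prob_bounds)
    qed
  qed
  also have "?g [] = 0"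
    by (simp add: real_clicks_def)
  also have "measure_pmf.expectation (run n \<mu> q A P t) ?g =
      measure_pmf.expectation (run n \<mu> q A P t) (\<lambda>h. real (real_clicks h) - click_prob * real t)"
    using run_support(1) by (intro expectation_pmf_cong) simp
  also have "\<dots> = expected_clicks n t \<mu> q A P - click_prob * real t"
    by (simp add: expected_clicks_def integrable_run)
  finally show ?thesis by simp
qed

text \<open>The compensator \<open>l\<^sup>2 / 8\<close> is paid only in real rounds with feedback
  on \<open>i\<close>, so the random and adversarially influenced sample size does no harm; in all
  other rounds the exponent is unchanged.\<close>

lemma expectation_exp_le_1:
  fixes l :: real
  assumes i: "i \<in> {1..n}"
  shows "measure_pmf.expectation (run n \<mu> q A P t)
    (\<lambda>h. exp (l * (real (real_clicks_on h i) - real (real_feedback h i) * \<mu> i)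
      - l\<^sup>2 * real (real_feedback h i) / 8)) \<le> 1"
proof -
  let ?g = "\<lambda>h. exp (l * (real (real_clicks_on h i) - real (real_feedback h i) * \<mu> i)
      - l\<^sup>2 * real (real_feedback h i) / 8)"
  have "measure_pmf.expectation (run n \<mu> q A P t) ?g \<le> ?g []"
  proof (rule run_supermartingale)
    fix h :: history and \<pi> a
    assume \<pi>: "\<pi> \<in> R" and a: "a \<in> valid_actions n"
    show "measure_pmf.expectation (response n \<mu> q \<pi> a) (\<lambda>c. ?g (h @ [(\<pi>, a \<noteq> Real_User, c)])) \<le> ?g h"
    proof (cases "a = Real_User")
      case True
      let ?M = "examine \<mu> q \<pi> (n - 1) 1"
      let ?G = "\<lambda>c. if feedback_on i \<pi> c
        then exp (l * (of_bool (fst c = Some i) - \<mu> i) - l\<^sup>2 / 8) else 1 :: real"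
      have "measure_pmf.expectation ?M (\<lambda>c. ?g (h @ [(\<pi>, False, c)]))
          = measure_pmf.expectation ?M (\<lambda>c. ?g h * ?G c)"
        by (intro expectation_pmf_cong)
           (auto simp: real_clicks_on_def real_feedback_def algebra_simps add_divide_distrib
             simp flip: exp_add)
      also have "\<dots> = ?g h * measure_pmf.expectation ?M ?G"
        by (rule integral_mult_right_zero)
      also have "\<dots> \<le> ?g h"
        using examine_exp_bound[of \<pi> i l] i \<pi> R_rankings by (intro mult_left_le) auto
      finally show ?thesis using True by simp
    next
      case False
      then show ?thesis
        by (intro expectation_pmf_le finite_set_pmf_response)
           (auto simp: real_clicks_on_def real_feedback_def)
    qed
  qed
  also have "?g [] = 1"
    by (simp add: real_clicks_on_def real_feedback_def)
  finally show ?thesis .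
qed

text \<open>
  With the exponent \<open>\<plusminus>4 sqrt (L / m)\<close> tuned to \<open>m\<close> observations, a deviation of \<open>sqrt (L * m)\<close>
  makes the exponential supermartingale at least \<open>exp (2 * L)\<close>.
\<close>

lemma not_concentrated_prob:
  assumes "L > 0"
  shows "measure_pmf.expectation (run n \<mu> q A P t) (\<lambda>h. of_bool (\<not> concentrated n \<mu> L h))
    \<le> 2 * real n * real t ^ 2 * exp (- 2 * L)"
proof -
  let ?p = "run n \<mu> q A P t"
  define l where "l = (\<lambda>m :: nat. 4 * sqrt (L / real m))"
  define M where "M = (\<lambda>l i h. exp (l * (real (real_clicks_on h i) - real (real_feedback h i) * \<mu> i)
      - l\<^sup>2 * real (real_feedback h i) / 8))"
  \<comment> \<open>Union bound over the prefix, the product, the possible values \<open>m\<close>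
    of its random count and the sign of the deviation: \<open>2 * n * t\<^sup>2\<close> terms, each
    of expectation at most 1.\<close>
  define \<Phi> where "\<Phi> = (\<lambda>h. \<Sum>s = 1..t. \<Sum>i = 1..n. \<Sum>m = 1..t. \<Sum>\<sigma> \<in> {-1, 1}. M (\<sigma> * l m) i (take s h))"
  have M_pos: "M l i h \<ge> 0" for l i h by (simp add: M_def)
  have "measure_pmf.expectation ?p (\<lambda>h. of_bool (\<not> concentrated n \<mu> L h))
      \<le> measure_pmf.expectation ?p (\<lambda>h. exp (- 2 * L) * \<Phi> h)"
  proof (intro expectation_pmf_mono finite_set_pmf_run)
    fix h assume h: "h \<in> set_pmf ?p"
    show "of_bool (\<not> concentrated n \<mu> L h) \<le> exp (- 2 * L) * \<Phi> h"
    proof (cases "concentrated n \<mu> L h")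
      case True
      then show ?thesis by (auto simp: \<Phi>_def M_pos intro!: sum_nonneg add_nonneg_nonneg mult_nonneg_nonneg)
    next
      case False
      then obtain s i where s: "s \<le> length h" and i: "i \<in> {1..n}"
        and m0: "real_feedback (take s h) i > 0"
        and dev: "\<bar>real (real_clicks_on (take s h) i) - real (real_feedback (take s h) i) * \<mu> i\<bar>
          \<ge> sqrt (L * real (real_feedback (take s h) i))"
        by (auto simp: concentrated_def Let_def not_less)
      define m where "m = real_feedback (take s h) i"
      define D where "D = real (real_clicks_on (take s h) i) - real m * \<mu> i"
      define \<sigma> :: real where "\<sigma> = (if D \<ge> 0 then 1 else -1)"
      have \<sigma>: "\<sigma> * D = \<bar>D\<bar>" "\<sigma>\<^sup>2 = 1" "\<sigma> \<in> {-1, 1}" by (auto simp: \<sigma>_def)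
      have "m \<le> s" using real_feedback_le_length[of "take s h" i] s by (simp add: m_def)
      then have ms: "m \<in> {1..t}" "s \<in> {1..t}"
        using m0 s run_support(1)[OF h] by (auto simp: m_def)
      have m: "real m > 0" using m0 by (simp add: m_def)
      have "2 * L = l m * sqrt (L * real m) - (l m)\<^sup>2 * real m / 8"
      proof -
        have "sqrt (L / real m) * sqrt (L * real m) = sqrt (L * L)"
          unfolding real_sqrt_mult[symmetric] using m by simp
        then have "l m * sqrt (L * real m) = 4 * L" using assms by (simp add: l_def)
        moreover have "(l m)\<^sup>2 * real m / 8 = 2 * L"
          using m assms by (simp add: l_def power_mult_distrib)
        ultimately show ?thesis by simp
      qed
      also have "\<dots> \<le> l m * \<bar>D\<bar> - (l m)\<^sup>2 * real m / 8"
        using dev assms by (auto simp: l_def D_def m_def intro!: mult_left_mono)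
      also have "\<dots> = \<sigma> * l m * D - (\<sigma> * l m)\<^sup>2 * real m / 8"
        using \<sigma> by (simp add: power_mult_distrib algebra_simps)
      finally have "exp (2 * L) \<le> M (\<sigma> * l m) i (take s h)"
        by (simp add: M_def D_def m_def)
      also have "\<dots> \<le> (\<Sum>\<sigma> \<in> {-1, 1}. M (\<sigma> * l m) i (take s h))"
        using \<sigma>(3) M_pos
        by (intro member_le_sum[where f = "\<lambda>\<sigma>. M (\<sigma> * l m) i (take s h)"]) auto
      also have "\<dots> \<le> (\<Sum>m = 1..t. \<Sum>\<sigma> \<in> {-1, 1}. M (\<sigma> * l m) i (take s h))"
        using ms(1) M_pos
        by (intro member_le_sum[where f = "\<lambda>m. \<Sum>\<sigma> \<in> {-1, 1}. M (\<sigma> * l m) i (take s h)"])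
          (auto intro!: sum_nonneg add_nonneg_nonneg)
      also have "\<dots> \<le> (\<Sum>i = 1..n. \<Sum>m = 1..t. \<Sum>\<sigma> \<in> {-1, 1}. M (\<sigma> * l m) i (take s h))"
        using i M_pos
        by (intro member_le_sum[where f = "\<lambda>i. \<Sum>m = 1..t. \<Sum>\<sigma> \<in> {-1, 1}. M (\<sigma> * l m) i (take s h)"])
          (auto intro!: sum_nonneg add_nonneg_nonneg)
      also have "\<dots> \<le> \<Phi> h"
        unfolding \<Phi>_def
        using ms(2) M_pos
        by (intro member_le_sum[where f = "\<lambda>s. \<Sum>i = 1..n. \<Sum>m = 1..t. \<Sum>\<sigma> \<in> {-1, 1}. M (\<sigma> * l m) i (take s h)"])
          (auto intro!: sum_nonneg add_nonneg_nonneg)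
      finally show ?thesis using False by (simp add: exp_minus field_simps)
    qed
  qed
  also have "\<dots> = exp (- 2 * L) * (\<Sum>s = 1..t. \<Sum>i = 1..n. \<Sum>m = 1..t. \<Sum>\<sigma> \<in> {-1, 1}.
      measure_pmf.expectation ?p (\<lambda>h. M (\<sigma> * l m) i (take s h)))"
    unfolding \<Phi>_def by (subst integral_mult_right_zero)
      (simp add: Bochner_Integration.integral_sum integrable_run)
  also have "\<dots> \<le> exp (- 2 * L) * (\<Sum>s = 1..t. \<Sum>i = 1..n. \<Sum>m = 1..t. \<Sum>\<sigma> \<in> {-1, 1 :: real}. 1)"
  proof (intro mult_left_mono sum_mono)
    fix s i m and \<sigma> :: real
    assume s: "s \<in> {1..t}" and i: "i \<in> {1..n}"
    have "measure_pmf.expectation ?p (\<lambda>h. M (\<sigma> * l m) i (take s h))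
        = measure_pmf.expectation (map_pmf (take s) ?p) (M (\<sigma> * l m) i)"
      by simp
    also have "\<dots> \<le> 1"
      using map_take_run[of s t] s expectation_exp_le_1[OF i, of s "\<sigma> * l m"] by (simp add: M_def)
    finally show "measure_pmf.expectation ?p (\<lambda>h. M (\<sigma> * l m) i (take s h)) \<le> 1" .
  qed simp
  finally show ?thesis by (simp add: power2_eq_square mult_ac)
qed

end

section \<open>Feedback on misranked products\<close>

text \<open>The logarithm in the confidence radius of FAR with \<open>\<delta> = 1 / (n * T)\<close>
  inserted, that is, the logarithm of \<open>2 * (n * T)\<^sup>2\<close>.\<close>

abbreviation conf_log :: "nat \<Rightarrow> nat \<Rightarrow> real" where
  "conf_log n T \<equiv> ln (2 * real n * real T / (1 / (real n * real T)))"

lemma conf_log_pos: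
  assumes "n \<ge> 1" "T \<ge> 1"
  shows "conf_log n T > 0"
proof -
  have "1 \<le> real n * real T" using assms by (simp add: mult_ge1_I)
  then have "1 \<le> (real n * real T) * (real n * real T)" by (simp add: mult_ge1_I)
  then show ?thesis by (simp add: algebra_simps)
qed

lemma observed_take: "take s (observed h) = observed (take s h)"
  by (simp add: observed_def take_map)

lemma length_observed: "length (observed h) = length h"
  by (simp add: observed_def)

lemma fake_count_take_le: "fake_count (take s h) \<le> fake_count h"
  by (metis append_take_drop_id fake_count_def filter_append le_add1 length_append)

lemma feedback_count_observed_snoc:
  "feedback_count (observed (h @ [(\<pi>, f, c)])) i
     = feedback_count (observed h) i + of_bool (feedback_on i \<pi> c)"
  by (simp add: feedback_count_def observed_def feedback_on_def)

lemma feedback_count_le_length: "feedback_count obs i \<le> length obs"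
  unfolding feedback_count_def by (rule length_filter_le)

text \<open>Each fake round with feedback on \<open>i\<close> shifts the clicks minus
  \<open>\<eta> * p\<close> by at most 1, so all of them together by at most \<open>F\<close>. The
  real rounds contribute less than \<open>sqrt (L * \<eta>)\<close>; division by
  \<open>\<eta>\<close> gives the radius.\<close>

lemma click_rate_close:
  assumes conc: "real_feedback h i > 0 \<Longrightarrow>
      \<bar>real (real_clicks_on h i) - real (real_feedback h i) * p\<bar> < sqrt (L * real (real_feedback h i))"
    and L: "L > 0" and p: "0 \<le> p" "p \<le> 1" and F: "real (fake_count h) \<le> F"
    and pos: "feedback_count (observed h) i > 0"
  defines "\<eta> \<equiv> real (feedback_count (observed h) i)"
  shows "\<bar>click_rate (observed h) i - p\<bar> < sqrt (L / \<eta>) + F / \<eta>"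
proof -
  define k where "k = length (filter (\<lambda>(\<pi>, c). i \<in> \<pi> ` {1..snd c} \<and> fst c = Some i) (observed h))"
  \<comment> \<open>\<open>ff\<close> counts the fake rounds with feedback on \<open>i\<close>,
    \<open>fc\<close> those among them with a click on \<open>i\<close>.\<close>
  have "\<exists>fc ff. feedback_count (observed h) i = real_feedback h i + ff \<and>
      k = real_clicks_on h i + fc \<and> fc \<le> ff \<and> ff \<le> fake_count h"
    unfolding k_def
  proof (induction h)
    case Nil
    then show ?case
      by (simp add: feedback_count_def observed_def real_feedback_def real_clicks_on_def)
  next
    case (Cons x h)
    obtain \<pi> f c where x: "x = (\<pi>, f, c)" by (cases x)
    from Cons obtain fc ff where IH: "feedback_count (observed h) i = real_feedback h i + ff"
      "length (filter (\<lambda>(\<pi>, c). i \<in> \<pi> ` {1..snd c} \<and> fst c = Some i) (observed h)) = real_clicks_on h i + fc"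
      "fc \<le> ff" "ff \<le> fake_count h" by blast
    show ?case
      by (rule exI[of _ "fc + of_bool (f \<and> feedback_on i \<pi> c \<and> fst c = Some i)"],
          rule exI[of _ "ff + of_bool (f \<and> feedback_on i \<pi> c)"])
         (use IH in \<open>auto simp: x feedback_count_def observed_def real_feedback_def
            real_clicks_on_def fake_count_def feedback_on_def\<close>)
  qed
  then obtain fc ff where dec: "feedback_count (observed h) i = real_feedback h i + ff"
    "k = real_clicks_on h i + fc" "fc \<le> ff" "ff \<le> fake_count h" by blast
  let ?m = "real (real_feedback h i)" and ?C = "real (real_clicks_on h i)"
  have \<eta>: "\<eta> > 0" "\<eta> = ?m + real ff" by (use pos in \<open>simp add: \<eta>_def\<close>) (use dec in \<open>simp add: \<eta>_def\<close>)
  have "\<bar>?C - ?m * p\<bar> < sqrt (L * \<eta>)"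
  proof (cases "real_feedback h i = 0")
    \<comment> \<open>Without real feedback \<open>conc\<close> gives nothing, but then there are no
      real clicks either, and \<open>\<eta> > 0\<close> keeps the bound strict.\<close>
    case True
    moreover have "real_clicks_on h i \<le> real_feedback h i"
      unfolding real_clicks_on_def real_feedback_def
      by (induction h) auto
    ultimately show ?thesis using L \<eta> by simp
  next
    case False
    then have "\<bar>?C - ?m * p\<bar> < sqrt (L * ?m)" using conc by simp
    also have "\<dots> \<le> sqrt (L * \<eta>)" using L \<eta> by simp
    finally show ?thesis .
  qed
  moreover have "\<bar>real fc - real ff * p\<bar> \<le> F"
  proof -
    have "0 \<le> real ff * p" "real ff * p \<le> real ff" using p by (auto simp: mult_left_le)
    then show ?thesis using dec F by linarith
  qed
  ultimately have "\<bar>real k - \<eta> * p\<bar> < sqrt (L * \<eta>) + F"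
    using dec \<eta> by (simp add: algebra_simps)
  then have "\<bar>real k - \<eta> * p\<bar> / \<eta> < (sqrt (L * \<eta>) + F) / \<eta>"
    using \<eta> by (simp add: divide_strict_right_mono)
  moreover have "\<bar>real k - \<eta> * p\<bar> / \<eta> = \<bar>real k / \<eta> - p\<bar>"
  proof -
    have "real k / \<eta> - p = (real k - \<eta> * p) / \<eta>" using \<eta>(1) by (simp add: field_simps)
    then show ?thesis using \<eta>(1) by (simp add: abs_divide)
  qed
  moreover have "sqrt (L * \<eta>) / \<eta> = sqrt (L / \<eta>)"
    using \<eta>(1) by (simp add: real_sqrt_mult real_sqrt_divide real_div_sqrt field_simps)
  ultimately show ?thesis
    by (simp add: click_rate_def k_def \<eta>_def add_divide_distrib)
qed

context market
begin

section \<open>Correctness of the graph and of the selection under concentration\<close>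

context
  fixes T :: nat and F :: real and h :: history
  assumes T: "T \<ge> 1" and conc: "concentrated n \<mu> (conf_log n T) h"
    and budget: "real (fake_count h) \<le> F"
begin

lemmas L_pos = conf_log_pos[OF n_ge_1 T]

lemma budget_nonneg: "F \<ge> 0"
  using budget by (meson of_nat_0_le_iff order_trans)

lemma click_rate_bounds:
  assumes "s \<le> length h" "i \<in> {1..n}" "feedback_count (observed (take s h)) i > 0"
  defines "\<eta> \<equiv> real (feedback_count (observed (take s h)) i)"
  shows "\<bar>click_rate (observed (take s h)) i - \<mu> i\<bar> < sqrt (conf_log n T / \<eta>) + F / \<eta>"
  unfolding \<eta>_def
proof (rule click_rate_close[OF _ L_pos _ _ _ assms(3)])
  show "real (fake_count (take s h)) \<le> F"
    using budget fake_count_take_le[of s h] by linarith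
qed (use conc \<mu>_range assms in \<open>auto simp: concentrated_def Let_def\<close>)

text \<open>The true click probabilities lie in their confidence intervals after every round, so
  separated intervals are ordered like the click probabilities, and a better product has a smaller
  index.\<close>

lemma far_graph_edge:
  assumes "(i, j) \<in> far_graph n T F (observed h)"
  shows "j < i"
proof -
  from assms obtain s where ij: "i \<in> {1..n}" "j \<in> {1..n}" and s: "s \<le> length h"
    and sep: "separated n T F (observed (take s h)) i j"
    by (auto simp: far_graph_def observed_take length_observed)
  have pos: "feedback_count (observed (take s h)) i > 0" "feedback_count (observed (take s h)) j > 0"
    using sep by (simp_all add: separated_def Let_def)
  have "\<mu> i < \<mu> j"
    using click_rate_bounds[OF s ij(1) pos(1)] click_rate_bounds[OF s ij(2) pos(2)] sep
    unfolding separated_def Let_def by linarith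
  then show ?thesis using \<mu>_antimono[of i j] ij by (meson not_le_imp_less not_less)
qed

lemma acyclic_far_graph: "acyclic (far_graph n T F (observed h))"
proof (rule acyclic_subset)
  show "acyclic ({(i, j). j < i} :: (nat \<times> nat) set)"
    using wf_less wf_acyclic acyclic_converse by (fastforce simp: converse_unfold)
qed (use far_graph_edge in auto)

text \<open>
  The best remaining product has no outgoing edge, so the product chosen instead has at most as
  much feedback and has not been separated from it: its confidence width is still at least a
  quarter of the gap.
\<close>

lemma feedback_count_le_of_misranked:
  assumes \<pi>: "\<pi> \<in> graph_rank_select n (feedback_count (observed h)) (far_graph n T F (observed h))"
    and j: "j \<in> {1..n}" and b_less: "best_left n \<pi> j < \<pi> j"
  defines "\<Delta> \<equiv> \<mu> (best_left n \<pi> j) - \<mu> (\<pi> j)"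
  shows "real (feedback_count (observed h) (\<pi> j)) \<le> 64 * conf_log n T / \<Delta>\<^sup>2 + 8 * F / \<Delta>"
proof -
  let ?\<eta> = "feedback_count (observed h)" and ?G = "far_graph n T F (observed h)"
  let ?L = "conf_log n T"
  let ?S = "{1..n} - \<pi> ` {1..<j}"
  define a where "a = \<pi> j"
  define b where "b = best_left n \<pi> j"
  have rk: "\<pi> \<in> rankings n" using \<pi> by (simp add: graph_rank_select_def)
  note bm = best_left_mem[OF rk j, folded b_def a_def]
  have b_min: "b \<le> k" if "k \<in> ?S" for k
    unfolding b_def best_left_def using that by (intro Min_le) auto
  have min: "is_arg_min ?\<eta> (\<lambda>i. i \<in> ?S \<and> (\<forall>k \<in> ?S - {i}. (i, k) \<notin> ?G)) a"
    using \<pi> j acyclic_far_graph by (auto simp: graph_rank_select_def Let_def a_def)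
  \<comment> \<open>Edges lead to smaller indices and \<open>b\<close> is the smallest one left, so
    \<open>b\<close> was eligible when \<open>a\<close> was chosen.\<close>
  have "\<forall>k \<in> ?S - {b}. (b, k) \<notin> ?G"
    using b_min far_graph_edge by (meson DiffD1 leD)
  then have \<eta>_le: "?\<eta> a \<le> ?\<eta> b"
    using min bm(1) by (auto simp: is_arg_min_def not_less)
  have ba: "b < a" using b_less by (simp add: a_def b_def)
  have no_edge: "(a, b) \<notin> ?G"
    using min bm(1) ba by (auto simp: is_arg_min_def)
  have ab: "a \<in> {1..n}" "b \<in> {1..n}" using bm by auto
  have \<Delta>: "\<Delta> > 0" using \<mu>_decr[OF ab(2,1) ba] by (simp add: \<Delta>_def a_def b_def)
  show ?thesis
  proof (cases "?\<eta> a = 0")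
    case True
    then show ?thesis
      using \<Delta> budget_nonneg L_pos by (auto simp: a_def intro!: add_nonneg_nonneg divide_nonneg_nonneg)
  next
    case False
    define x where "x = real (?\<eta> a)"
    define y where "y = real (?\<eta> b)"
    have xy: "0 < x" "x \<le> y" using False \<eta>_le by (simp_all add: x_def y_def)
    \<comment> \<open>\<open>far_graph\<close> inspects prefixes of length at least 1; feedback on
      \<open>a\<close> shows that \<open>h\<close> is one of them.\<close>
    then have len: "length h \<in> {1..length (observed h)}"
      using feedback_count_le_length[of "observed h" a] False by (simp add: length_observed)
    have "\<not> separated n T F (observed h) a b"
    proof
      assume "separated n T F (observed h) a b"
      then have "separated n T F (take (length h) (observed h)) a b" by (simp add: length_observed)
      then show False using no_edge ab len unfolding far_graph_def by blast
    qed
    then have "click_rate (observed h) b - sqrt (?L / y) - F / y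
        < click_rate (observed h) a + sqrt (?L / x) + F / x"
      using xy by (simp add: separated_def Let_def x_def y_def)
    moreover have "\<bar>click_rate (observed h) a - \<mu> a\<bar> < sqrt (?L / x) + F / x"
      using click_rate_bounds[of "length h" a] ab xy by (simp add: x_def)
    moreover have "\<bar>click_rate (observed h) b - \<mu> b\<bar> < sqrt (?L / y) + F / y"
      using click_rate_bounds[of "length h" b] ab xy by (simp add: y_def)
    moreover have "sqrt (?L / y) \<le> sqrt (?L / x)" "F / y \<le> F / x"
      using xy budget_nonneg L_pos by (auto intro!: divide_left_mono)
    \<comment> \<open>Two radii come from the failed separation and one from each click rate; the
      radius of \<open>b\<close> is at most that of \<open>a\<close>.\<close>
    ultimately have D: "\<Delta> < 4 * sqrt (?L / x) + 4 * (F / x)"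
      unfolding \<Delta>_def a_def[symmetric] b_def[symmetric] by linarith
    have "x \<le> 64 * ?L / \<Delta>\<^sup>2 + 8 * F / \<Delta>"
    \<comment> \<open>One of the two summands is at least \<open>\<Delta> / 2\<close>: the fake one
      gives \<open>8 * F / \<Delta>\<close>, the statistical one
      \<open>64 * ?L / \<Delta>\<^sup>2\<close>.\<close>
    proof (cases "\<Delta> / 2 \<le> 4 * F / x")
      case True
      then have "x \<le> 8 * F / \<Delta>" using xy \<Delta> by (simp add: field_simps)
      then show ?thesis using L_pos by (simp add: add_increasing)
    next
      case False
      then have "\<Delta> \<le> 8 * sqrt (?L / x)" using D by simp
      then have "\<Delta>\<^sup>2 \<le> (8 * sqrt (?L / x))\<^sup>2" using \<Delta> by (intro power_mono) auto
      also have "\<dots> = 64 * ?L / x" using xy L_pos by (simp add: power_mult_distrib)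
      finally have "x \<le> 64 * ?L / \<Delta>\<^sup>2" using xy \<Delta> by (simp add: field_simps)
      then show ?thesis using \<Delta> budget_nonneg by (simp add: add_increasing2)
    qed
    then show ?thesis by (simp add: x_def a_def)
  qed
qed

end

text \<open>Amortisation: the right-hand side is a potential that never falls and grows by the gap
  whenever a pair is charged. As \<open>N b a\<close> bounds the count before the charge, the count
  is capped at \<open>N b a + 1\<close>. Leaving \<open>N\<close> open covers the good and the bad
  event.\<close>

lemma loss_le_sum_pairs:
  fixes N :: "nat \<Rightarrow> nat \<Rightarrow> real"
  assumes "\<And>s. s < length h \<Longrightarrow> fst (h ! s) \<in> rankings n"
    and "\<And>s. s < length h \<Longrightarrow> \<not> fst (snd (h ! s)) \<Longrightarrow> snd (snd (snd (h ! s))) \<le> n"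
    and "\<And>s j. s < length h \<Longrightarrow> j \<in> {1..n} \<Longrightarrow> best_left n (fst (h ! s)) j < fst (h ! s) j \<Longrightarrow>
      real (feedback_count (observed (take s h)) (fst (h ! s) j))
        \<le> N (best_left n (fst (h ! s)) j) (fst (h ! s) j)"
    and N_nonneg: "\<And>b a. N b a \<ge> 0"
  shows "loss n \<mu> h \<le> (\<Sum>a = 1..n. \<Sum>b = 1..<a. (\<mu> b - \<mu> a) *
    min (real (feedback_count (observed h) a)) (N b a + 1))"
  using assms(1-3)
proof (induction h rule: rev_induct)
  case Nil
  then show ?case using N_nonneg
    by (auto simp: loss_def feedback_count_def observed_def add_nonneg_nonneg min_def
        intro!: sum_nonneg mult_nonneg_nonneg)
next
  case (snoc x h)
  obtain \<pi> f c where x: "x = (\<pi>, f, c)" by (cases x)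
  let ?\<eta> = "\<lambda>h a. real (feedback_count (observed h) a)"
  let ?B = "\<lambda>h. \<Sum>a = 1..n. \<Sum>b = 1..<a. (\<mu> b - \<mu> a) * min (?\<eta> h a) (N b a + 1)"
  have pre: "(h @ [x]) ! s = h ! s" "take s (h @ [x]) = take s h" if "s < length h" for s
    using that by (simp_all add: nth_append)
  have IH: "loss n \<mu> h \<le> ?B h"
  proof (rule snoc.IH)
    fix s assume s: "s < length h"
    then have s': "s < length (h @ [x])" by simp
    show "fst (h ! s) \<in> rankings n" using snoc.prems(1)[OF s'] pre[OF s] by simp
    show "snd (snd (snd (h ! s))) \<le> n" if "\<not> fst (snd (h ! s))"
      using snoc.prems(2)[OF s'] pre[OF s] that by simp
    show "?\<eta> (take s h) (fst (h ! s) j) \<le> N (best_left n (fst (h ! s)) j) (fst (h ! s) j)"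
      if "j \<in> {1..n}" "best_left n (fst (h ! s)) j < fst (h ! s) j" for j
      using snoc.prems(3)[OF s'] pre[OF s] that by simp
  qed
  have rk: "\<pi> \<in> rankings n" using snoc.prems(1)[of "length h"] by (simp add: x)
  have cn: "\<not> f \<Longrightarrow> snd c \<le> n" using snoc.prems(2)[of "length h"] by (simp add: x)
  have small: "?\<eta> h (\<pi> j) \<le> N (best_left n \<pi> j) (\<pi> j)"
    if "j \<in> {1..n}" "best_left n \<pi> j < \<pi> j" for j
    using snoc.prems(3)[of "length h" j] that by (simp add: x)
  \<comment> \<open>\<open>H a\<close> bounds the charge for showing \<open>a\<close> without
    reference to the best product left, so the sum over positions becomes a sum over
    products.\<close>
  define H where "H = (\<lambda>a. \<Sum>b = 1..<a. if ?\<eta> h a \<le> N b a then \<mu> b - \<mu> a else 0)"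
  have \<mu>_diff: "0 \<le> \<mu> b - \<mu> a" if "a \<in> {1..n}" "b \<in> {1..<a}" for a b
    using \<mu>_decr[of b a] that by simp
  have H_nonneg: "0 \<le> H a" if "a \<in> {1..n}" for a
    unfolding H_def using \<mu>_diff[OF that] by (intro sum_nonneg) simp
  have gap_le: "gap n \<mu> \<pi> j \<le> H (\<pi> j)" if j: "j \<in> {1..n}" for j
  proof (cases "best_left n \<pi> j = \<pi> j")
    case True
    then show ?thesis using H_nonneg best_left_mem(4)[OF rk j] by (simp add: gap_def)
  next
    case False
    let ?b = "best_left n \<pi> j"
    note bm = best_left_mem[OF rk j]
    have b: "?b \<in> {1..<\<pi> j}" using False bm by auto
    have "gap n \<mu> \<pi> j = (if ?\<eta> h (\<pi> j) \<le> N ?b (\<pi> j) then \<mu> ?b - \<mu> (\<pi> j) else 0)"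
      using small[OF j] b by (simp add: gap_def)
    also have "\<dots> \<le> H (\<pi> j)"
      unfolding H_def using b \<mu>_diff[OF bm(4)]
      by (intro member_le_sum[where f = "\<lambda>b. if ?\<eta> h (\<pi> j) \<le> N b (\<pi> j) then \<mu> b - \<mu> (\<pi> j) else 0"]) auto
    finally show ?thesis .
  qed
  have "round_loss n \<mu> x \<le> (\<Sum>a = 1..n. if feedback_on a \<pi> c then H a else 0)"
  proof (cases f)
    case True
    then show ?thesis using H_nonneg by (auto simp: round_loss_def x intro!: sum_nonneg)
  next
    case False
    have "round_loss n \<mu> x = (\<Sum>j = 1..snd c. gap n \<mu> \<pi> j)" using False by (simp add: round_loss_def x)
    also have "\<dots> \<le> (\<Sum>j = 1..snd c. H (\<pi> j))"
      using cn[OF False] by (intro sum_mono gap_le) auto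
    also have "\<dots> = (\<Sum>a \<in> \<pi> ` {1..snd c}. H a)"
      using rk by (subst sum.reindex) (auto simp: rankings_def permutes_inj_on)
    also have "\<dots> \<le> (\<Sum>a \<in> {a \<in> {1..n}. feedback_on a \<pi> c}. H a)"
      using cn[OF False] H_nonneg best_left_mem(4)[OF rk]
      by (intro sum_mono2) (auto simp: feedback_on_def)
    also have "\<dots> = (\<Sum>a = 1..n. if feedback_on a \<pi> c then H a else 0)"
      by (subst sum.inter_filter) auto
    finally show ?thesis .
  qed
  also have "\<dots> \<le> (\<Sum>a = 1..n. \<Sum>b = 1..<a. (\<mu> b - \<mu> a) *
      (min (?\<eta> (h @ [x]) a) (N b a + 1) - min (?\<eta> h a) (N b a + 1)))"
  proof (intro sum_mono)
    fix a assume a: "a \<in> {1..n}"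
    show "(if feedback_on a \<pi> c then H a else 0) \<le> (\<Sum>b = 1..<a. (\<mu> b - \<mu> a) *
      (min (?\<eta> (h @ [x]) a) (N b a + 1) - min (?\<eta> h a) (N b a + 1)))"
    proof (cases "feedback_on a \<pi> c")
      case True
      have "H a \<le> (\<Sum>b = 1..<a. (\<mu> b - \<mu> a) *
          (min (?\<eta> (h @ [x]) a) (N b a + 1) - min (?\<eta> h a) (N b a + 1)))"
        unfolding H_def
      proof (intro sum_mono)
        fix b assume "b \<in> {1..<a}"
        then have "0 \<le> \<mu> b - \<mu> a" by (rule \<mu>_diff[OF a])
        \<comment> \<open>The count of \<open>a\<close> grows by 1; if it was at most
          \<open>N b a\<close>, the cap at \<open>N b a + 1\<close> does not bind and the minimum
          grows by 1 as well.\<close>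
        then show "(if ?\<eta> h a \<le> N b a then \<mu> b - \<mu> a else 0) \<le> (\<mu> b - \<mu> a) *
            (min (?\<eta> (h @ [x]) a) (N b a + 1) - min (?\<eta> h a) (N b a + 1))"
          using True by (auto simp: x feedback_count_observed_snoc min_def)
      qed
      then show ?thesis using True by simp
    next
      case False
      then show ?thesis by (simp add: x feedback_count_observed_snoc)
    qed
  qed
  also have "\<dots> = ?B (h @ [x]) - ?B h"
    by (simp add: right_diff_distrib sum_subtractf)
  finally have "round_loss n \<mu> x \<le> ?B (h @ [x]) - ?B h" .
  then show ?case using IH by (simp add: loss_def)
qed

end

section \<open>The regret bound\<close>

text \<open>Shows that the supremum in \<open>regret\<close> ranges over a nonempty set.\<close>

lemma (in market) real_policy_mem:
  assumes "F \<ge> 0"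
  shows "(\<lambda>_. return_pmf Real_User) \<in> fake_policies n T F \<mu> q"
proof -
  have "fake_count h = 0" if "h \<in> set_pmf (run n \<mu> q A (\<lambda>_. return_pmf Real_User) t)" for h A t
    using that
  proof (induction t arbitrary: h)
    case (Suc t)
    then show ?case by (fastforce simp: fake_count_def)
  qed (simp add: fake_count_def)
  then show ?thesis using assms by (simp add: fake_policies_def valid_actions_def)
qed

lemma sum_pairs_swap:
  "(\<Sum>a = 1..n. \<Sum>b = 1..<a. f b a) = (\<Sum>b = 1..n. \<Sum>a = b + 1..n. f b a)"
  for f :: "nat \<Rightarrow> nat \<Rightarrow> real"
proof -
  have "(\<Sum>a = 1..n. \<Sum>b = 1..<a. f b a) = (\<Sum>(a, b) \<in> (SIGMA a:{1..n}. {1..<a}). f b a)"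
    by (rule sum.Sigma) auto
  also have "\<dots> = (\<Sum>(b, a) \<in> (SIGMA b:{1..n}. {b + 1..n}). f b a)"
    by (rule sum.reindex_bij_witness[of _ prod.swap prod.swap]) auto
  also have "\<dots> = (\<Sum>b = 1..n. \<Sum>a = b + 1..n. f b a)"
    by (rule sum.Sigma[symmetric]) auto
  finally show ?thesis .
qed

text \<open>The constant 2 inside the logarithm is absorbed by a third factor
  \<open>n * T\<close>.\<close>

lemma conf_log_le:
  assumes "real n * real T \<ge> 2"
  shows "conf_log n T \<le> 3 * ln (real n * real T)"
proof -
  let ?x = "real n * real T"
  have "2 * real n * real T / (1 / ?x) = 2 * ?x ^ 2" by (simp add: power2_eq_square)
  also have "\<dots> \<le> ?x * ?x ^ 2" using assms by (intro mult_right_mono) auto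
  also have "\<dots> = ?x ^ 3" by (simp add: power_numeral_reduce power2_eq_square mult_ac)
  finally have "2 * real n * real T / (1 / ?x) \<le> ?x ^ 3" .
  moreover have "0 < 2 * real n * real T / (1 / ?x)" using assms by (intro divide_pos_pos) (auto simp: mult.assoc)
  ultimately have "conf_log n T \<le> ln (?x ^ 3)" by (rule ln_mono)
  also have "\<dots> = 3 * ln ?x" using assms by (simp add: ln_realpow)
  finally show ?thesis .
qed

context market
begin

lemma FAR_regret_le:
  assumes T: "T \<ge> 1" and F: "F \<ge> 0" and A: "is_FAR n T F A" and P: "P \<in> fake_policies n T F \<mu> q"
  shows "expected_clicks n T \<mu> q (\<lambda>_. return_pmf id) P - expected_clicks n T \<mu> q A P
    \<le> 200 * (real n ^ 2 * F + (\<Sum>j = 1..n. \<Sum>i = j + 1..n. ln (real n * real T) / (\<mu> j - \<mu> i)))"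
proof -
  have id_rank: "{id} \<subseteq> rankings n" by (simp add: rankings_def permutes_id)
  have A_sub: "set_pmf (A obs) \<subseteq> graph_rank_select n (feedback_count obs) (far_graph n T F obs)" for obs
    using A by (simp add: is_FAR_def)
  then have A_rank: "set_pmf (A obs) \<subseteq> rankings n" for obs
    by (auto simp: graph_rank_select_def)
  have P_valid: "set_pmf (P h) \<subseteq> valid_actions n" for h using P by (simp add: fake_policies_def)
  interpret opt: market_run n \<mu> q "{id}" "\<lambda>_. return_pmf id" P
    using id_rank P_valid by unfold_locales auto
  interpret far: market_run n \<mu> q "rankings n" A P
    using A_rank P_valid by unfold_locales auto
  let ?p = "run n \<mu> q A P T"
  let ?L = "conf_log n T"
  have budget: "real (fake_count h) \<le> F" if "h \<in> set_pmf ?p" for h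
    using P A_rank that unfolding fake_policies_def by blast
  have nT1: "1 \<le> real n" "1 \<le> real T" using n_ge_1 T by simp_all
  have L_pos: "?L > 0" using conf_log_pos n_ge_1 T .
  let ?bad = "\<lambda>h. \<not> concentrated n \<mu> ?L h"
  define \<epsilon> where "\<epsilon> = measure_pmf.expectation ?p (\<lambda>h. of_bool (?bad h) :: real)"
  \<comment> \<open>A bad history costs at most \<open>T + 1\<close> per pair. Since
    \<open>exp (- 2 * ?L)\<close> is \<open>1 / (4 * (n * T) ^ 4)\<close>, the union bound makes
    this at most 1 in expectation.\<close>
  have \<epsilon>: "(real T + 1) * \<epsilon> \<le> 1"
  proof -
    let ?x = "real n * real T"
    have x: "?x > 0" using nT1 by simp
    have "exp (- 2 * ?L) = 1 / (exp ?L) ^ 2"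
      by (simp add: exp_minus field_simps flip: exp_of_nat_mult)
    also have "exp ?L = 2 * ?x ^ 2"
      using x by (subst exp_ln) (auto simp: power2_eq_square zero_less_mult_iff)
    finally have e: "exp (- 2 * ?L) = 1 / (2 * ?x ^ 2) ^ 2" .
    have "(real T + 1) * \<epsilon> \<le> (2 * real T) * (2 * real n * real T ^ 2 * exp (- 2 * ?L))"
      unfolding \<epsilon>_def using far.not_concentrated_prob[OF L_pos, of T] nT1
      by (intro mult_mono) (auto intro!: integral_nonneg)
    also have "\<dots> = 1 / (real n ^ 3 * real T)"
      unfolding e using nT1 by (simp add: field_simps power_numeral_reduce)
    also have "\<dots> \<le> 1" using nT1 by (simp add: mult_ge1_I)
    finally show ?thesis .
  qed
  \<comment> \<open>The absolute value makes \<open>?N\<close> nonnegative for all arguments, as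
    \<open>loss_le_sum_pairs\<close> demands.\<close>
  let ?N = "\<lambda>b a. 64 * ?L / (\<mu> b - \<mu> a)\<^sup>2 + 8 * F / \<bar>\<mu> b - \<mu> a\<bar>"
  let ?pair = "\<lambda>b a. (\<mu> b - \<mu> a) * (?N b a + 1)"
  have \<Delta>: "0 < \<mu> b - \<mu> a" "\<mu> b - \<mu> a \<le> 1" if "a \<in> {1..n}" "b \<in> {1..<a}" for a b
    using \<mu>_decr[of b a] \<mu>_range[of a] \<mu>_range[of b] that by auto
  have loss_le: "loss n \<mu> h \<le> (\<Sum>a = 1..n. \<Sum>b = 1..<a. ?pair b a + (real T + 1) * of_bool (?bad h))"
    if h: "h \<in> set_pmf ?p" for h
  proof -
    note sup = far.run_support[OF h]
    have rk: "fst (h ! s) \<in> rankings n" if "s < length h" for s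
      using sup A_rank that by auto
    show ?thesis
    proof (cases "?bad h")
      case True
      have "loss n \<mu> h \<le> (\<Sum>a = 1..n. \<Sum>b = 1..<a. (\<mu> b - \<mu> a) *
          min (real (feedback_count (observed h) a)) (real T + 1))"
      \<comment> \<open>On the bad event only the trivial bound remains: no count exceeds the number
        of rounds.\<close>
      proof (rule loss_le_sum_pairs[where N = "\<lambda>_ _. real T"])
        fix s j assume "s < length h"
        then show "real (feedback_count (observed (take s h)) (fst (h ! s) j)) \<le> real T"
          using feedback_count_le_length[of "observed (take s h)" "fst (h ! s) j"] sup(1)
          by (simp add: length_observed)
      qed (use rk sup in auto)
      also have "\<dots> \<le> (\<Sum>a = 1..n. \<Sum>b = 1..<a. ?pair b a + (real T + 1) * of_bool (?bad h))"
      proof (intro sum_mono)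
        fix a b assume ab: "a \<in> {1..n}" "b \<in> {1..<a}"
        have "(\<mu> b - \<mu> a) * min (real (feedback_count (observed h) a)) (real T + 1) \<le> 1 * (real T + 1)"
          using \<Delta>[OF ab] by (intro mult_mono) auto
        also have "\<dots> \<le> ?pair b a + (real T + 1) * of_bool (?bad h)"
          using True \<Delta>[OF ab] F L_pos by (auto intro!: mult_nonneg_nonneg add_nonneg_nonneg divide_nonneg_nonneg)
        finally show "(\<mu> b - \<mu> a) * min (real (feedback_count (observed h) a)) (real T + 1)
          \<le> ?pair b a + (real T + 1) * of_bool (?bad h)" .
      qed
      finally show ?thesis .
    next
      case False
      have "loss n \<mu> h \<le> (\<Sum>a = 1..n. \<Sum>b = 1..<a. (\<mu> b - \<mu> a) *
          min (real (feedback_count (observed h) a)) (?N b a + 1))"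
      proof (rule loss_le_sum_pairs[where N = ?N])
        fix s j assume s: "s < length h" and j: "j \<in> {1..n}"
          and less: "best_left n (fst (h ! s)) j < fst (h ! s) j"
        have conc: "concentrated n \<mu> ?L (take s h)"
          using False by (auto simp: concentrated_def min_def split: if_splits)
        have bud: "real (fake_count (take s h)) \<le> F"
          using budget[OF h] fake_count_take_le[of s h] by linarith
        have "fst (h ! s) \<in> graph_rank_select n (feedback_count (observed (take s h)))
            (far_graph n T F (observed (take s h)))"
          using sup s A_sub by auto
        moreover have "0 \<le> \<mu> (best_left n (fst (h ! s)) j) - \<mu> (fst (h ! s) j)"
          using gap_nonneg[OF rk[OF s] j] by (simp add: gap_def)
        ultimately show "real (feedback_count (observed (take s h)) (fst (h ! s) j))
            \<le> ?N (best_left n (fst (h ! s)) j) (fst (h ! s) j)"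
          using feedback_count_le_of_misranked[OF T conc bud _ j less] by simp
      next
        show "?N b a \<ge> 0" for b a
          using L_pos F by (intro add_nonneg_nonneg divide_nonneg_nonneg) auto
      qed (use rk sup in auto)
      also have "\<dots> \<le> (\<Sum>a = 1..n. \<Sum>b = 1..<a. ?pair b a + (real T + 1) * of_bool (?bad h))"
      proof (intro sum_mono)
        fix a b assume ab: "a \<in> {1..n}" "b \<in> {1..<a}"
        have "(\<mu> b - \<mu> a) * min (real (feedback_count (observed h) a)) (?N b a + 1) \<le> ?pair b a"
          using \<Delta>[OF ab] by (intro mult_left_mono) auto
        then show "(\<mu> b - \<mu> a) * min (real (feedback_count (observed h) a)) (?N b a + 1)
          \<le> ?pair b a + (real T + 1) * of_bool (?bad h)" using False by simp
      qed
      finally show ?thesis .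
    qed
  qed
  have "measure_pmf.expectation ?p (loss n \<mu>)
      \<le> measure_pmf.expectation ?p (\<lambda>h. \<Sum>a = 1..n. \<Sum>b = 1..<a. ?pair b a + (real T + 1) * of_bool (?bad h))"
    by (intro expectation_pmf_mono far.finite_set_pmf_run loss_le)
  also have "\<dots> = (\<Sum>a = 1..n. \<Sum>b = 1..<a. ?pair b a + (real T + 1) * \<epsilon>)"
    unfolding \<epsilon>_def
    by (simp add: Bochner_Integration.integral_sum Bochner_Integration.integral_add
        far.integrable_run)
  also have "\<dots> \<le> (\<Sum>a = 1..n. \<Sum>b = 1..<a. 8 * F + 196 * (ln (real n * real T) / (\<mu> b - \<mu> a)))"
  proof (intro sum_mono)
    fix a b assume ab: "a \<in> {1..n}" "b \<in> {1..<a}"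
    note d = \<Delta>[OF ab]
    have "n \<ge> 2" using ab by auto
    then have nT2: "2 \<le> real n * real T"
      using mult_mono[of 2 "real n" 1 "real T"] nT1 by simp
    let ?d = "\<mu> b - \<mu> a" and ?l = "ln (real n * real T)"
    \<comment> \<open>Additive constants are absorbed into the logarithm: a pair exists, so
      \<open>n * T\<close> is at least 2, which exceeds \<open>exp (1 / 2)\<close>.\<close>
    have "1 \<le> 2 * ?l"
    proof -
      have "exp (1 / 2 :: real) \<le> 1 + 1 / 2 + (1 / 2)\<^sup>2"
        by (rule exp_bound) auto
      then have "exp (1 / 2) \<le> real n * real T" using nT2 by (simp add: power2_eq_square)
      then have "1 / 2 \<le> ?l" using nT2 by (subst ln_ge_iff) auto
      then show ?thesis by simp
    qed
    then have one: "1 \<le> 2 * (?l / ?d)"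
      using d by (simp add: field_simps)
    have "x * (64 * ?L / x\<^sup>2 + 8 * F / \<bar>x\<bar> + 1) = 64 * (?L / x) + 8 * F + x" if "x > 0" for x :: real
      using that by (simp add: field_simps power2_eq_square)
    from this[OF d(1)] have "?pair b a = 64 * (?L / ?d) + 8 * F + ?d" .
    moreover have "?L / ?d \<le> 3 * (?l / ?d)"
      using divide_right_mono[OF conf_log_le[OF nT2], of ?d] d by simp
    \<comment> \<open>The constant is \<open>64 * 3 + 4\<close>: the gap and the bad event cost at
      most 1 each, hence together at most \<open>4 * (?l / ?d)\<close>.\<close>
    ultimately show "?pair b a + (real T + 1) * \<epsilon> \<le> 8 * F + 196 * (?l / ?d)"
      using one \<epsilon> d(2) by linarith
  qed
  also have "\<dots> = (\<Sum>a = 1..n. \<Sum>b = 1..<a. 8 * F)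
      + 196 * (\<Sum>j = 1..n. \<Sum>i = j + 1..n. ln (real n * real T) / (\<mu> j - \<mu> i))"
    unfolding sum_pairs_swap[symmetric] by (simp add: sum.distrib sum_distrib_left)
  also have "(\<Sum>a = 1..n. \<Sum>b = 1..<a. 8 * F) \<le> (\<Sum>a = 1..n. \<Sum>b = 1..n. 8 * F)"
    using F by (intro sum_mono sum_mono2) auto
  also have "\<dots> = 8 * (real n ^ 2 * F)" by (simp add: power2_eq_square)
  finally have loss: "measure_pmf.expectation ?p (loss n \<mu>) \<le> 8 * (real n ^ 2 * F)
      + 196 * (\<Sum>j = 1..n. \<Sum>i = j + 1..n. ln (real n * real T) / (\<mu> j - \<mu> i))" by simp
  have fakes: "click_prob * measure_pmf.expectation ?p (\<lambda>h. real (fake_count h)) \<le> real n ^ 2 * F"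
  proof -
    have "click_prob * measure_pmf.expectation ?p (\<lambda>h. real (fake_count h)) \<le> 1 * F"
      using budget F click_prob_bounds
      by (intro mult_mono expectation_pmf_le far.finite_set_pmf_run) (auto intro!: integral_nonneg)
    also have "\<dots> \<le> real n ^ 2 * F" using nT1 F by (intro mult_right_mono) auto
    finally show ?thesis .
  qed
  have pairs_nonneg: "0 \<le> (\<Sum>j = 1..n. \<Sum>i = j + 1..n. ln (real n * real T) / (\<mu> j - \<mu> i))"
    unfolding sum_pairs_swap[symmetric] using \<Delta> nT1
    by (intro sum_nonneg divide_nonneg_nonneg) (auto simp: mult_ge1_I less_imp_le)
  \<comment> \<open>Both runs are compared with \<open>click_prob * T\<close>, which
    cancels.\<close>
  have "expected_clicks n T \<mu> q (\<lambda>_. return_pmf id) P - expected_clicks n T \<mu> q A P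
      \<le> click_prob * measure_pmf.expectation ?p (\<lambda>h. real (fake_count h))
        + measure_pmf.expectation ?p (loss n \<mu>)"
    using opt.expectation_clicks_id_upper[of T] far.expectation_clicks_lower[of T]
    by (simp add: algebra_simps)
  then have "expected_clicks n T \<mu> q (\<lambda>_. return_pmf id) P - expected_clicks n T \<mu> q A P
      \<le> 9 * (real n ^ 2 * F)
      + 196 * (\<Sum>j = 1..n. \<Sum>i = j + 1..n. ln (real n * real T) / (\<mu> j - \<mu> i))"
    using loss fakes by linarith
  moreover have "0 \<le> real n ^ 2 * F" using F by simp
  ultimately show ?thesis using pairs_nonneg by (simp add: distrib_left)
qed

end

theorem theorem2:
  "\<exists>C > 0. \<forall>(n :: nat) (T :: nat) (F :: real) (\<mu> :: nat \<Rightarrow> real) (q :: nat \<Rightarrow> real) (A :: platform).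
     n \<ge> 1 \<and> T \<ge> 1 \<and> F \<ge> 0 \<and>
     (\<forall>i \<in> {1..n}. 0 \<le> \<mu> i \<and> \<mu> i \<le> 1) \<and>
     (\<forall>i \<in> {1..n}. \<forall>j \<in> {1..n}. i < j \<longrightarrow> \<mu> j < \<mu> i) \<and>
     (\<forall>j \<in> {1..<n}. 0 \<le> q j \<and> q j \<le> 1) \<and>
     is_FAR n T F A
     \<longrightarrow> regret n T F \<mu> q A
          \<le> C * (real n ^ 2 * F
               + (\<Sum>j = 1..n. \<Sum>i = j + 1..n. ln (real n * real T) / (\<mu> j - \<mu> i)))"
proof (intro exI[of _ 200] conjI allI impI, goal_cases)
  case (2 n T F \<mu> q A)
  then interpret market n \<mu> q by unfold_locales auto
  have "fake_policies n T F \<mu> q \<noteq> {}" using real_policy_mem 2 by blast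
  then show ?case
    unfolding regret_def using 2 by (intro cSUP_least FAR_regret_le) auto
qed simp

end
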